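(* A postcritically finite McMullen map is uniquely determined by its Julia set: if $n,\tilde n\ge 2$ are integers, $\lambda,\tilde\lambda\in\mathbb{C}\setminus\{0\}$, the maps $f(z)=z^n+\lambda/z^n$ and $\tilde f(z)=z^{\tilde n}+\tilde\lambda/z^{\tilde n}$ are postcritically finite, and the Julia sets of $f$ and $\tilde f$ are equal as subsets of $\overline{\mathbb{C}}$, then $n=\tilde n$ and $\lambda=\tilde\lambda$.
   Context: A McMullen map is a rational map of the form $z\mapsto z^n+\lambda/z^n$ with $n\ge2$ an integer and $\lambda\in\mathbb{C}\setminus\{0\}$. A rational map is postcritically finite (PCF) if all its critical points are eventually periodic. *)

theory Defs
  imports "HOL-Analysis.Analysis"
begin

text \<open>
  The Riemann sphere is the one-point compactification of the complex plane, carried by the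
  type \<open>complex option\<close> with \<open>None\<close> as the point at infinity.
\<close>

type_synonym rsphere = "complex option"

definition rsphere_top :: "rsphere topology" where
  "rsphere_top = Alexandroff_compactification euclidean"

text \<open>
  Inverse stereographic projection onto the unit sphere of \<open>complex \<times> real\<close>. The Euclidean
  distance of the images is the chordal metric
  \<open>2 * cmod (z - w) / sqrt ((1 + (cmod z)\<^sup>2) * (1 + (cmod w)\<^sup>2))\<close>, which induces the topology
  \<open>rsphere_top\<close>; uniform convergence of sphere-valued maps is meant with respect to it.
\<close>

fun stereo :: "rsphere \<Rightarrow> complex \<times> real" where
  "stereo None = (0, 1)"
| "stereo (Some z) =
     (2 * z / of_real (1 + (cmod z)\<^sup>2), ((cmod z)\<^sup>2 - 1) / (1 + (cmod z)\<^sup>2))"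

definition normal_family_on :: "rsphere set \<Rightarrow> (rsphere \<Rightarrow> rsphere) set \<Rightarrow> bool" where
  "normal_family_on U F \<longleftrightarrow>
     (\<forall>h :: nat \<Rightarrow> rsphere \<Rightarrow> rsphere. range h \<subseteq> F \<longrightarrow>
       (\<exists>r g. strict_mono r \<and>
         (\<forall>K. compactin rsphere_top K \<and> K \<subseteq> U \<longrightarrow>
           uniform_limit K (\<lambda>k x. stereo (h (r k) x)) (\<lambda>x. stereo (g x)) sequentially)))"

definition fatou_set :: "(rsphere \<Rightarrow> rsphere) \<Rightarrow> rsphere set" where
  "fatou_set f = \<Union>{U. openin rsphere_top U \<and> normal_family_on U (range (\<lambda>k. f ^^ k))}"

definition julia_set :: "(rsphere \<Rightarrow> rsphere) \<Rightarrow> rsphere set" where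
  "julia_set f = - fatou_set f"

text \<open>
  Holomorphic coordinates centred at a point \<open>p\<close>: \<open>w - a\<close> at a finite point \<open>a\<close>, and \<open>1 / w\<close>
  at infinity. The values \<open>coord (Some a) None\<close> and \<open>coord None (Some 0)\<close> are junk, at points
  outside the domain of the coordinate.
\<close>

fun coord :: "rsphere \<Rightarrow> rsphere \<Rightarrow> complex" where
  "coord (Some a) (Some w) = w - a"
| "coord (Some a) None = 0"
| "coord None (Some w) = inverse w"
| "coord None None = 0"

fun inv_coord :: "rsphere \<Rightarrow> complex \<Rightarrow> rsphere" where
  "inv_coord (Some a) w = Some (a + w)"
| "inv_coord None w = (if w = 0 then None else Some (inverse w))"

definition critical_point :: "(rsphere \<Rightarrow> rsphere) \<Rightarrow> rsphere \<Rightarrow> bool" where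
  "critical_point f p \<longleftrightarrow>
     ((\<lambda>w. coord (f p) (f (inv_coord p w))) has_field_derivative 0) (at 0)"

definition eventually_periodic :: "('a \<Rightarrow> 'a) \<Rightarrow> 'a \<Rightarrow> bool" where
  "eventually_periodic f x \<longleftrightarrow> (\<exists>k m. m > 0 \<and> (f ^^ (k + m)) x = (f ^^ k) x)"

definition postcritically_finite :: "(rsphere \<Rightarrow> rsphere) \<Rightarrow> bool" where
  "postcritically_finite f \<longleftrightarrow> (\<forall>p. critical_point f p \<longrightarrow> eventually_periodic f p)"

fun mcmullen_map :: "nat \<Rightarrow> complex \<Rightarrow> rsphere \<Rightarrow> rsphere" where
  "mcmullen_map n c None = None"
| "mcmullen_map n c (Some z) = (if z = 0 then None else Some (z ^ n + c / z ^ n))"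

end

theory Submission
  imports Defs "HOL-Complex_Analysis.Complex_Analysis"
begin

text \<open>
  Near infinity the map \<open>f z = z ^ n + c / z ^ n\<close> is conjugate to \<open>w \<mapsto> w ^ n\<close> by the Boettcher
  coordinate. In the chart \<open>\<xi> = 1 / z\<close>, where \<open>f\<close> becomes
  \<open>\<xi> \<mapsto> \<xi> ^ n / (1 + c * \<xi> ^ (2 * n))\<close>, the inverse of this coordinate has the form
  \<open>\<psi> w = w * e w\<close> with \<open>e 0 = 1\<close>. The proof recovers \<open>\<psi>\<close> from the Julia set and then \<open>n\<close> and \<open>c\<close>
  from \<open>\<psi>\<close>.

  If \<open>f\<close> is postcritically finite, then \<open>\<psi>\<close> extends to an injective map on the whole unit disc. An
  extension from radius \<open>r\<close> to radius \<open>root n r\<close> amounts to solving \<open>f z = 1 / \<psi> (w ^ n)\<close> for \<open>z\<close>. This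
  equation is quadratic in \<open>z ^ n\<close>, with a discriminant that vanishes exactly when
  \<open>1 / \<psi> (w ^ n)\<close> is one of the critical values \<open>\<plusminus> 2 * csqrt c\<close>. A critical value \<open>1 / \<psi> w\<close> would
  have the infinite orbit \<open>1 / \<psi> (w ^ n ^ k)\<close>, so the discriminant has a square root on the disc
  (\<open>inverse_boettcher_factor_extend\<close>, \<open>postcritically_finite_imp_noncritical\<close>).

  The image of the unit disc under \<open>\<psi>\<close> is the immediate basin of infinity. It lies in the Fatou set
  because points in it escape locally uniformly. No point of its frontier lies in the Fatou set:
  normality there would make the nearby basin points escape at a common rate, whereas basin points
  close to the frontier escape arbitrarily slowly. So the image is the component of the complement
  of the Julia set that contains infinity, and two maps with the same Julia set have the same image
  (\<open>basin_subset_fatou_set\<close>, \<open>basin_frontier_disjoint_fatou_set\<close>, \<open>immediate_basin_subset\<close>).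

  Two injective parametrisations of the same domain by the disc, both fixing \<open>0\<close> with derivative
  \<open>1\<close>, coincide by the Schwarz lemma. Finally \<open>\<psi>\<close> determines the parameters, since the
  conjugacy forces \<open>\<psi> w = w + (c / n) * w ^ (2 * n + 1) + \<dots>\<close>
  (\<open>inverse_boettcher_factor_leading_term\<close>).
\<close>


section \<open>Holomorphic roots\<close>

lemma contractible_imp_holomorphic_root:
  fixes f :: "complex \<Rightarrow> complex"
  assumes "f holomorphic_on S" "contractible S" "\<And>z. z \<in> S \<Longrightarrow> f z \<noteq> 0"
    and a: "a \<in> S" "f a = 1" and n: "n > 0"
  obtains g where "g holomorphic_on S" "g a = 1" "\<And>z. z \<in> S \<Longrightarrow> g z ^ n = f z"
proof -
  obtain l where hol: "l holomorphic_on S" and l: "\<And>z. z \<in> S \<Longrightarrow> f z = exp (l z)"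
    using contractible_imp_holomorphic_log[OF assms(1-3)] by blast
  show thesis
  proof
    show "(\<lambda>z. exp ((l z - l a) / of_nat n)) holomorphic_on S"
      using n by (intro holomorphic_intros hol) auto
    show "exp ((l z - l a) / of_nat n) ^ n = f z" if "z \<in> S" for z
      using l[OF that] l[OF a(1)] a(2) n by (simp flip: exp_of_nat_mult add: exp_diff)
  qed simp
qed

text \<open>
  The quotient of two continuous functions with equal \<open>n\<close>-th powers takes values in the finite set of
  \<open>n\<close>-th roots of unity, so it is constant on a connected set.
\<close>

lemma power_eq_imp_eq_on_connected:
  fixes f g :: "'a::topological_space \<Rightarrow> complex"
  assumes conn: "connected S" and cont: "continuous_on S f" "continuous_on S g"
    and eq: "\<And>x. x \<in> S \<Longrightarrow> f x ^ n = g x ^ n" and nz: "\<And>x. x \<in> S \<Longrightarrow> g x \<noteq> 0"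
    and n: "n > 0" and a: "a \<in> S" "f a = g a" and x: "x \<in> S"
  shows "f x = g x"
proof -
  have "(\<lambda>x. f x / g x) ` S \<subseteq> {u. u ^ n = 1}"
    using eq nz by (auto simp: power_divide)
  moreover have "finite {u::complex. u ^ n = 1}"
    using n by (simp add: finite_roots_unity)
  ultimately have "finite ((\<lambda>x. f x / g x) ` S)"
    using finite_subset by blast
  moreover have "continuous_on S (\<lambda>x. f x / g x)"
    using cont nz by (intro continuous_intros) auto
  ultimately have "(\<lambda>x. f x / g x) constant_on S"
    using continuous_finite_range_constant[OF conn] by blast
  then have "f x / g x = f a / g a"
    using a x unfolding constant_on_def by metis
  then show ?thesis
    using a nz x by (simp add: divide_eq_1_iff)
qed

section \<open>Inverse Boettcher coordinates\<close>

text \<open>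
  The function \<open>w \<mapsto> w * e w\<close> is an inverse Boettcher coordinate in the chart \<open>\<xi> = 1 / z\<close>. Multiplied
  by \<open>w ^ n\<close>, the last clause is the conjugacy equation
  \<open>\<psi> w ^ n / (1 + c * \<psi> w ^ (2 * n)) = \<psi> (w ^ n)\<close> for \<open>\<psi> w = w * e w\<close>, cleared of its denominator. The
  factor \<open>e\<close>, unlike \<open>\<psi>\<close>, has no zero, so that roots of it can be extracted.
\<close>

definition inverse_boettcher_factor ::
  "nat \<Rightarrow> complex \<Rightarrow> real \<Rightarrow> (complex \<Rightarrow> complex) \<Rightarrow> bool" where
  "inverse_boettcher_factor n c r e \<longleftrightarrow>
     e holomorphic_on ball 0 r \<and> e 0 = 1 \<and> (\<forall>w \<in> ball 0 r. e w \<noteq> 0) \<and>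
     inj_on (\<lambda>w. w * e w) (ball 0 r) \<and>
     (\<forall>w \<in> ball 0 r. e w ^ n = (1 + c * (w * e w) ^ (2 * n)) * e (w ^ n))"

lemma norm_power_less_radius:
  fixes w :: complex
  assumes "norm w < r" "r \<le> 1" "n \<ge> 1"
  shows "norm (w ^ n) < r"
proof -
  have "norm w ^ n \<le> norm w ^ 1"
    using assms by (intro power_decreasing) auto
  then show ?thesis using assms by (simp add: norm_power)
qed

text \<open>
  Boettcher's construction. With \<open>F\<close> the map in the chart \<open>\<xi>\<close>, the coordinate is the infinite product
  \<open>\<Phi> \<xi> = \<xi> * (\<Prod>j. (1 + c * (F ^^ j) \<xi> ^ (2 * n)) powr (- 1 / n ^ (j + 1)))\<close>, the limit of the \<open>n ^ j\<close>-th
  roots of \<open>(F ^^ j) \<xi>\<close>. The sum \<open>S\<close> below is minus the logarithm of \<open>\<Phi> \<xi> / \<xi>\<close>. Shifting the index of the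
  sum gives \<open>\<Phi> (F \<xi>) = \<Phi> \<xi> ^ n\<close>, and \<open>e\<close> is \<open>exp S\<close> at the local inverse of \<open>\<Phi>\<close>.
\<close>

lemma local_inverse_boettcher_factor:
  assumes n: "n \<ge> 2"
  obtains r e where "0 < r" "r \<le> 1" "inverse_boettcher_factor n c r e"
proof -
  define F where "F = (\<lambda>z. z ^ n / (1 + c * z ^ (2 * n)))"
  \<comment> \<open>On this disc \<open>norm (c * z ^ (2 * n)) < 1 / 2\<close>, so that \<open>Ln\<close> is holomorphic and \<open>F\<close> does not increase the modulus.\<close>
  define \<rho> where "\<rho> = 1 / (2 * (norm c + 1))"
  have c_pos: "norm c + 1 > 0" by (simp add: add_nonneg_pos)
  then have \<rho>: "0 < \<rho>" "\<rho> \<le> 1 / 2" by (auto simp: \<rho>_def field_simps)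
  have small: "norm (c * z ^ (2 * n)) < 1 / 2" if "z \<in> ball 0 \<rho>" for z
  proof -
    have "norm z ^ (2 * n) \<le> norm z ^ 1"
      using that \<rho> n by (intro power_decreasing) auto
    then have "norm c * norm z ^ (2 * n) \<le> norm c * \<rho>"
      using that by (intro mult_left_mono) auto
    also have "\<dots> < 1 / 2"
      using c_pos by (simp add: \<rho>_def field_simps)
    finally show ?thesis by (simp add: norm_mult norm_power)
  qed
  have large: "norm (1 + c * z ^ (2 * n)) > 1 / 2" "Re (1 + c * z ^ (2 * n)) > 0"
    if "z \<in> ball 0 \<rho>" for z
  proof -
    show "norm (1 + c * z ^ (2 * n)) > 1 / 2"
      using norm_triangle_ineq2[of 1 "- (c * z ^ (2 * n))"] small[OF that] by simp
    have "\<bar>Re (c * z ^ (2 * n))\<bar> < 1 / 2"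
      using abs_Re_le_cmod[of "c * z ^ (2 * n)"] small[OF that] by linarith
    then show "Re (1 + c * z ^ (2 * n)) > 0" unfolding plus_complex.sel one_complex.sel by linarith
  qed
  have F_le: "norm (F z) \<le> norm z" if z: "z \<in> ball 0 \<rho>" for z
  proof -
    have "norm (F z) \<le> norm z ^ n / (1 / 2)"
      unfolding F_def norm_divide norm_power using large(1)[OF z]
      by (intro divide_left_mono) (auto simp: mult_pos_pos)
    also have "\<dots> \<le> 2 * norm z ^ 2"
      using z \<rho> n power_decreasing[of 2 n "norm z"] by auto
    also have "\<dots> \<le> norm z"
      using z \<rho> mult_right_mono[of "2 * norm z" 1 "norm z"] by (simp add: power2_eq_square)
    finally show ?thesis .
  qed
  have F_hol: "F holomorphic_on ball 0 \<rho>"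
    unfolding F_def using large(1) by (intro holomorphic_intros) force+
  have iter: "(F ^^ j) ` ball 0 \<rho> \<subseteq> ball 0 \<rho> \<and> (F ^^ j) holomorphic_on ball 0 \<rho>" for j
  proof (induction j)
    case (Suc j)
    have "F ` ball 0 \<rho> \<subseteq> ball 0 \<rho>" using F_le by fastforce
    then show ?case
      using Suc holomorphic_on_compose_gen[of "F ^^ j" "ball 0 \<rho>" F "ball 0 \<rho>"] F_hol
      by (auto simp: o_def)
  qed (auto simp: holomorphic_on_ident)
  define T where "T = (\<lambda>j z. Ln (1 + c * (F ^^ j) z ^ (2 * n)) / of_nat n ^ Suc j)"
  define S where "S = (\<lambda>z. \<Sum>j. T j z)"
  have T_hol: "T j holomorphic_on ball 0 \<rho>" for j
  proof -
    have "1 + c * (F ^^ j) z ^ (2 * n) \<notin> \<real>\<^sub>\<le>\<^sub>0" if "z \<in> ball 0 \<rho>" for z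
    proof -
      have "(F ^^ j) z \<in> ball 0 \<rho>" using iter[of j] that by blast
      then show ?thesis using large(2) by (fastforce simp: complex_nonpos_Reals_iff)
    qed
    then show ?thesis
      unfolding T_def using iter[of j] n by (intro holomorphic_intros) auto
  qed
  have T_le: "norm (T j z) \<le> (1 / real n) ^ Suc j" if "z \<in> ball 0 \<rho>" for j z
  proof -
    have "(F ^^ j) z \<in> ball 0 \<rho>" using iter[of j] that by blast
    then have "norm (Ln (1 + c * (F ^^ j) z ^ (2 * n))) \<le> 1"
      using norm_Ln_le[OF small] small by fastforce
    then show ?thesis
      using n by (simp add: T_def norm_divide norm_mult norm_power power_divide divide_right_mono)
  qed
  have sum_M: "summable (\<lambda>j. (1 / real n) ^ Suc j)"
    unfolding summable_Suc_iff using n by (intro summable_geometric) auto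
  have T_sum: "summable (\<lambda>j. T j z)" if "z \<in> ball 0 \<rho>" for z
    by (rule summable_comparison_test'[OF sum_M T_le[OF that]])
  have S_hol: "S holomorphic_on ball 0 \<rho>"
  proof (rule holomorphic_uniform_sequence)
    show "(\<lambda>z. \<Sum>j<N. T j z) holomorphic_on ball 0 \<rho>" for N
      by (intro holomorphic_intros T_hol)
    fix x :: complex assume "x \<in> ball 0 \<rho>"
    then obtain d where "d > 0" "cball x d \<subseteq> ball 0 \<rho>"
      using open_contains_cball open_ball by blast
    moreover have "uniform_limit (ball 0 \<rho>) (\<lambda>N z. \<Sum>j<N. T j z) S sequentially"
      unfolding S_def by (rule Weierstrass_m_test[OF T_le sum_M])
    ultimately show "\<exists>d. 0 < d \<and> cball x d \<subseteq> ball 0 \<rho> \<and>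
        uniform_limit (cball x d) (\<lambda>N z. \<Sum>j<N. T j z) S sequentially"
      using uniform_limit_on_subset by blast
  qed auto
  have S_F: "of_nat n * S z = Ln (1 + c * z ^ (2 * n)) + S (F z)" if z: "z \<in> ball 0 \<rho>" for z
  proof -
    have "T (Suc j) z = T j (F z) / of_nat n" for j
      by (simp add: T_def funpow_swap1)
    moreover have "F z \<in> ball 0 \<rho>" using F_le[OF z] z by auto
    ultimately have "(\<Sum>j. T (Suc j) z) = S (F z) / of_nat n"
      using T_sum by (simp add: S_def suminf_divide)
    moreover have "S z = T 0 z + (\<Sum>j. T (Suc j) z)"
      unfolding S_def using suminf_split_head[OF T_sum[OF z]] by simp
    ultimately show ?thesis using n by (simp add: T_def field_simps)
  qed
  have exp_S: "exp (S z) ^ n = (1 + c * z ^ (2 * n)) * exp (S (F z))" if z: "z \<in> ball 0 \<rho>" for z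
  proof -
    have "1 + c * z ^ (2 * n) \<noteq> 0" using large(1)[OF z] by auto
    then show ?thesis using S_F[OF z] by (simp add: exp_add flip: exp_of_nat_mult)
  qed
  have F0: "F 0 = 0" using n by (simp add: F_def)
  have "(F ^^ j) 0 = 0" for j by (induction j) (auto simp: F0)
  then have S0: "S 0 = 0" using n by (simp add: S_def T_def power_0_left)
  define \<Phi> where "\<Phi> = (\<lambda>z. z * exp (- S z))"
  have \<Phi>_hol: "\<Phi> holomorphic_on ball 0 \<rho>"
    unfolding \<Phi>_def by (intro holomorphic_intros S_hol)
  have \<Phi>_F: "\<Phi> (F z) = \<Phi> z ^ n" if z: "z \<in> ball 0 \<rho>" for z
  proof -
    have "1 + c * z ^ (2 * n) \<noteq> 0" using large(1)[OF z] by auto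
    then show ?thesis
      using exp_S[OF z] by (simp add: \<Phi>_def F_def exp_minus power_mult_distrib field_simps)
  qed
  have "(\<Phi> has_field_derivative 1) (at 0)"
  proof -
    have "S field_differentiable at 0"
      using S_hol \<rho> by (simp add: holomorphic_on_imp_differentiable_at)
    then obtain S' where "(S has_field_derivative S') (at 0)"
      using field_differentiable_def by blast
    then show ?thesis
      unfolding \<Phi>_def by (auto intro!: derivative_eq_intros simp: S0)
  qed
  then have dnz: "deriv \<Phi> 0 \<noteq> 0" using DERIV_imp_deriv by force
  have in0: "0 \<in> ball 0 \<rho>" using \<rho> by simp
  obtain r1 where r1: "r1 > 0" "ball (0::complex) r1 \<subseteq> ball 0 \<rho>" "open (\<Phi> ` ball 0 r1)"
      "inj_on \<Phi> (ball 0 r1)"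
    by (rule has_complex_derivative_locally_invertible[OF \<Phi>_hol in0 open_ball dnz]) (rule that)
  obtain g where g: "g holomorphic_on \<Phi> ` ball 0 r1" "\<And>z. z \<in> ball 0 r1 \<Longrightarrow> g (\<Phi> z) = z"
    by (rule holomorphic_has_inverse[OF holomorphic_on_subset[OF \<Phi>_hol r1(2)] open_ball r1(4)]) (rule that)
  have "0 \<in> \<Phi> ` ball 0 r1"
    using r1(1) by (intro image_eqI[where x = 0]) (auto simp: \<Phi>_def)
  then obtain r' where r': "r' > 0" "ball 0 r' \<subseteq> \<Phi> ` ball 0 r1"
    using r1(3) open_contains_ball by blast
  define r where "r = min r' 1"
  have r: "r > 0" "r \<le> 1" "ball 0 r \<subseteq> \<Phi> ` ball 0 r1" using r' by (auto simp: r_def)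
  have g1: "g w \<in> ball 0 r1" "\<Phi> (g w) = w" if w: "w \<in> ball 0 r" for w
  proof -
    obtain z where "z \<in> ball 0 r1" "w = \<Phi> z" using r(3) w by blast
    then show "g w \<in> ball 0 r1" "\<Phi> (g w) = w" using g(2) by auto
  qed
  define e where "e = (\<lambda>w. exp (S (g w)))"
  have ge: "g w = w * e w" if "w \<in> ball 0 r" for w
    using g1(2)[OF that] by (simp add: e_def \<Phi>_def exp_minus field_simps)
  have gF: "g (w ^ n) = F (g w)" if w: "w \<in> ball 0 r" for w
  proof -
    have "F (g w) \<in> ball 0 r1"
      using F_le[of "g w"] g1(1)[OF w] r1(2) by force
    moreover have "\<Phi> (F (g w)) = w ^ n"
      using \<Phi>_F[of "g w"] g1[OF w] r1(2) by (metis subsetD)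
    ultimately show ?thesis using g(2) by metis
  qed
  have "inverse_boettcher_factor n c r e"
    unfolding inverse_boettcher_factor_def
  proof (intro conjI ballI)
    have "g holomorphic_on ball 0 r" using g(1) r(3) holomorphic_on_subset by blast
    moreover have "g ` ball 0 r \<subseteq> ball 0 \<rho>" using g1(1) r1(2) by blast
    ultimately have "(S \<circ> g) holomorphic_on ball 0 r"
      using holomorphic_on_compose_gen[OF _ S_hol] by blast
    then show "e holomorphic_on ball 0 r"
      unfolding e_def o_def by (intro holomorphic_intros)
    have "g 0 = 0" using ge[of 0] r(1) by simp
    then show "e 0 = 1" by (simp add: e_def S0)
    show "inj_on (\<lambda>w. w * e w) (ball 0 r)"
      by (rule inj_onI) (metis ge g1(2))
    fix w :: complex assume w: "w \<in> ball 0 r"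
    show "e w \<noteq> 0" by (simp add: e_def)
    show "e w ^ n = (1 + c * (w * e w) ^ (2 * n)) * e (w ^ n)"
      using exp_S[of "g w"] g1(1)[OF w] r1(2) gF[OF w] ge[OF w]
      by (metis e_def subsetD)
  qed
  then show thesis using that r by blast
qed

text \<open>
  The extension step. For \<open>\<psi> w = w * e w\<close>, a solution \<open>\<xi>\<close> of \<open>\<xi> ^ n / (1 + c * \<xi> ^ (2 * n)) = \<psi> x\<close> with
  \<open>x = w ^ n\<close> has \<open>\<xi> ^ n = 2 * \<psi> x / (1 + q x)\<close>, where \<open>q\<close> is the square root of \<open>1 - 4 * c * \<psi>\<^sup>2\<close> with
  \<open>q 0 = 1\<close>. The right-hand side is \<open>x\<close> times the zero-free function \<open>k x\<close>, so an \<open>n\<close>-th root \<open>K\<close> of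
  \<open>k\<close> yields \<open>\<xi> = w * K (w ^ n)\<close>, which is defined as soon as \<open>w ^ n\<close> lies in the old disc.
  Injectivity is inherited: equal values at \<open>a\<close> and \<open>b\<close> give \<open>a ^ n = b ^ n\<close>, and then the
  factors \<open>K (a ^ n)\<close> and \<open>K (b ^ n)\<close> cancel.
\<close>

lemma inverse_boettcher_factor_extend:
  assumes e: "inverse_boettcher_factor n c r e" and n: "n \<ge> 2" and c: "c \<noteq> 0"
    and r: "0 < r" "r \<le> 1" and s: "0 < s" "s ^ n = r"
    and noncrit: "\<And>w. w \<in> ball 0 r \<Longrightarrow> 1 - 4 * c * (w * e w)\<^sup>2 \<noteq> 0"
  obtains e' where "inverse_boettcher_factor n c s e'" "\<And>w. w \<in> ball 0 r \<Longrightarrow> e' w = e w"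
proof -
  have hol: "e holomorphic_on ball 0 r" and e0: "e 0 = 1"
    and nz: "\<And>w. w \<in> ball 0 r \<Longrightarrow> e w \<noteq> 0" and inj: "inj_on (\<lambda>w. w * e w) (ball 0 r)"
    and eq: "\<And>w. w \<in> ball 0 r \<Longrightarrow> e w ^ n = (1 + c * (w * e w) ^ (2 * n)) * e (w ^ n)"
    using e by (auto simp: inverse_boettcher_factor_def)
  have "s \<le> 1"
    using s r n by (metis linorder_not_le one_less_power order_less_le_trans not_numeral_le_zero)
  have rs: "r \<le> s"
    using power_decreasing[of 1 n s] s n \<open>s \<le> 1\<close> by simp
  have pow: "w ^ n \<in> ball 0 r" if "w \<in> ball 0 s" for w :: complex
  proof -
    have "norm w ^ n < s ^ n" using that n by (intro power_strict_mono) auto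
    then show ?thesis using s by (simp add: norm_power)
  qed
  have "(\<lambda>w. 1 - 4 * c * (w * e w)\<^sup>2) holomorphic_on ball 0 r"
    by (intro holomorphic_intros hol)
  then obtain q where q: "q holomorphic_on ball 0 r" "q 0 = 1"
      "\<And>w. w \<in> ball 0 r \<Longrightarrow> q w ^ 2 = 1 - 4 * c * (w * e w)\<^sup>2"
    using contractible_imp_holomorphic_root[where n = 2 and a = 0 and S = "ball 0 r"
        and f = "\<lambda>w. 1 - 4 * c * (w * e w)\<^sup>2"] noncrit r
    by (metis (no_types, lifting) centre_in_ball convex_ball convex_imp_contractible diff_zero
        mult_zero_left mult_zero_right zero_power2 zero_less_numeral)
  have qnz: "q w \<noteq> 0" if "w \<in> ball 0 r" for w
    using q(3)[OF that] noncrit[OF that] by auto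
  have q1: "1 + q w \<noteq> 0" if w: "w \<in> ball 0 r" for w
  proof
    assume "1 + q w = 0"
    then have "q w = -1" by (simp add: add_eq_0_iff)
    then have "c * (w * e w)\<^sup>2 = 0" using q(3)[OF w] by simp
    then have "w = 0" using nz[OF w] c by simp
    then show False using q(2) \<open>q w = -1\<close> by simp
  qed
  define k where "k = (\<lambda>w. 2 * e w / (1 + q w))"
  have k: "k holomorphic_on ball 0 r" "\<And>w. w \<in> ball 0 r \<Longrightarrow> k w \<noteq> 0" "k 0 = 1"
    unfolding k_def using q1 nz q(2) e0 by (auto intro!: holomorphic_intros hol q)
  have k_eq: "k x = (1 + c * x\<^sup>2 * (k x)\<^sup>2) * e x" if x: "x \<in> ball 0 r" for x
  proof -
    have "(1 + c * x\<^sup>2 * (k x)\<^sup>2) * e x * (1 + q x)\<^sup>2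
        = ((1 + q x)\<^sup>2 + 4 * c * (x * e x)\<^sup>2) * e x"
      using q1[OF x] by (simp add: k_def power_divide power_mult_distrib field_simps)
    also have "\<dots> = ((1 + q x)\<^sup>2 + 1 - (q x)\<^sup>2) * e x"
      using q(3)[OF x] by simp
    also have "\<dots> = k x * (1 + q x)\<^sup>2"
      using q1[OF x] by (simp add: k_def power2_eq_square field_simps)
    finally show ?thesis using q1[OF x] by simp
  qed
  obtain K where K: "K holomorphic_on ball 0 r" "K 0 = 1"
      "\<And>w. w \<in> ball 0 r \<Longrightarrow> K w ^ n = k w"
    using contractible_imp_holomorphic_root[OF k(1) _ k(2) _ k(3), of n] r n
    by (metis centre_in_ball convex_ball convex_imp_contractible not_numeral_le_zero
        bot_nat_0.not_eq_extremum)
  have Knz: "K w \<noteq> 0" if "w \<in> ball 0 r" for w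
    using K(3)[OF that] k(2)[OF that] n by (auto simp: power_0_left split: if_splits)
  define e' where "e' = (\<lambda>w. K (w ^ n))"
  have hol': "e' holomorphic_on ball 0 s"
    unfolding e'_def using pow
    by (intro holomorphic_on_compose_gen[OF _ K(1), unfolded o_def] holomorphic_intros) auto
  have agree: "e' w = e w" if w: "w \<in> ball 0 r" for w
  proof -
    have inr: "x ^ n \<in> ball 0 r" if "x \<in> ball 0 r" for x :: complex
      using pow that rs by auto
    have cont: "continuous_on (ball 0 r) (\<lambda>x. h (x ^ n))" if "h holomorphic_on ball 0 r" for h
      by (rule continuous_on_compose2[OF holomorphic_on_imp_continuous_on[OF that]])
        (use inr in \<open>auto intro!: continuous_intros\<close>)
    have conte: "continuous_on (ball 0 r) e" using hol holomorphic_on_imp_continuous_on by blast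
    \<comment> \<open>The old factor gives another square root \<open>a\<close> of the discriminant at \<open>x ^ n\<close>; it equals \<open>q\<close> because both are \<open>1\<close> at \<open>0\<close>.\<close>
    define a where "a = (\<lambda>x. 1 - 2 * c * (x ^ n)\<^sup>2 * e (x ^ n) * e x ^ n)"
    have aq: "a x = q (x ^ n)" if x: "x \<in> ball 0 r" for x
    proof (rule power_eq_imp_eq_on_connected[where S = "ball 0 r" and n = 2 and a = 0
          and f = a and g = "\<lambda>x. q (x ^ n)"])
      show "continuous_on (ball 0 r) a"
        unfolding a_def by (intro continuous_intros cont hol conte)
      show "continuous_on (ball 0 r) (\<lambda>x. q (x ^ n))" by (rule cont[OF q(1)])
      show "q (x ^ n) \<noteq> 0" if "x \<in> ball 0 r" for x using qnz inr that by blast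
      show "a 0 = q (0 ^ n)" using n q by (simp add: a_def power_0_left)
      fix x :: complex assume x: "x \<in> ball 0 r"
      define t where "t = e x ^ n"
      have t: "t - c * (x ^ n)\<^sup>2 * e (x ^ n) * t\<^sup>2 = e (x ^ n)"
        using eq[OF x] by (simp add: t_def power_mult_distrib power_mult algebra_simps
            flip: power_mult power2_eq_square) (simp add: power_mult mult.commute)
      have "(a x)\<^sup>2 = 1 - 4 * c * (x ^ n)\<^sup>2 * e (x ^ n) * (t - c * (x ^ n)\<^sup>2 * e (x ^ n) * t\<^sup>2)"
        unfolding a_def t_def[symmetric] by (simp add: power2_eq_square algebra_simps)
      then show "(a x) ^ 2 = q (x ^ n) ^ 2"
        using q(3)[OF inr[OF x]] unfolding t by (simp only: power2_eq_square mult_ac)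
    qed (use r x in auto)
    have "e x ^ n = k (x ^ n)" if x: "x \<in> ball 0 r" for x
    proof -
      have "e x ^ n * (1 + q (x ^ n)) = 2 * ((1 - c * (x ^ n)\<^sup>2 * e (x ^ n) * e x ^ n) * e x ^ n)"
        unfolding aq[OF x, symmetric] a_def by (simp add: algebra_simps)
      also have "(1 - c * (x ^ n)\<^sup>2 * e (x ^ n) * e x ^ n) * e x ^ n = e (x ^ n)"
        using eq[OF x] by (simp add: power_mult_distrib power_mult algebra_simps power2_eq_square
             mult_2 power_add)
      finally show ?thesis using q1[OF inr[OF x]] by (simp add: k_def field_simps)
    qed
    then have ee': "e x ^ n = e' x ^ n" if "x \<in> ball 0 r" for x
      using K(3)[OF inr] that by (simp add: e'_def)
    have "e w = e' w"
    proof (rule power_eq_imp_eq_on_connected[where S = "ball 0 r" and n = n and a = 0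
          and f = e and g = e'])
      show "continuous_on (ball 0 r) e'" unfolding e'_def by (rule cont[OF K(1)])
      show "e' x \<noteq> 0" if "x \<in> ball 0 r" for x using Knz inr that unfolding e'_def by blast
      show "e 0 = e' 0" using n e0 K(2) by (simp add: e'_def power_0_left)
    qed (use w r n conte ee' in auto)
    then show ?thesis by simp
  qed
  have eq': "e' w ^ n = (1 + c * (w * e' w) ^ (2 * n)) * e (w ^ n)" if w: "w \<in> ball 0 s" for w
  proof -
    have "(w * e' w) ^ (2 * n) = (w ^ n)\<^sup>2 * (k (w ^ n))\<^sup>2"
      using K(3)[OF pow[OF w]] by (simp add: e'_def power_mult_distrib power_mult mult.commute)
    then show ?thesis
      using k_eq[OF pow[OF w]] K(3)[OF pow[OF w]] by (simp add: e'_def mult.assoc)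
  qed
  have "inj_on (\<lambda>w. w * e' w) (ball 0 s)"
  proof (rule inj_onI)
    fix a b assume a: "a \<in> ball 0 s" and b: "b \<in> ball 0 s" and ab: "a * e' a = b * e' b"
    have *: "(w * e' w) ^ n = (1 + c * (w * e' w) ^ (2 * n)) * (w ^ n * e (w ^ n))"
      if "w \<in> ball 0 s" for w
      using eq'[OF that] by (simp add: power_mult_distrib)
    have nz: "1 + c * (w * e' w) ^ (2 * n) \<noteq> 0" if "w \<in> ball 0 s" for w
      using eq'[OF that] Knz[OF pow[OF that]] by (auto simp: e'_def)
    have "a ^ n * e (a ^ n) = b ^ n * e (b ^ n)"
      using *[OF a] *[OF b] nz[OF a] ab by (metis mult_left_cancel)
    then have "a ^ n = b ^ n"
      using inj pow[OF a] pow[OF b] by (auto dest: inj_onD)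
    then have "e' a = e' b" by (simp add: e'_def)
    then show "a = b" using ab Knz[OF pow[OF a]] by (auto simp: e'_def)
  qed
  moreover have "e' w ^ n = (1 + c * (w * e' w) ^ (2 * n)) * e' (w ^ n)" if "w \<in> ball 0 s" for w
    using eq'[OF that] agree[OF pow[OF that]] by simp
  ultimately have "inverse_boettcher_factor n c s e'"
    unfolding inverse_boettcher_factor_def
    using hol' Knz pow K(2) n by (auto simp: e'_def power_0_left)
  then show thesis using agree that by blast
qed

text \<open>
  Successive extensions reach the radii \<open>root (n ^ j) r0\<close>, which tend to \<open>1\<close>; each agrees with the
  previous one, so that together they define a function on the unit disc.
\<close>

lemma global_inverse_boettcher_factor:
  assumes n: "n \<ge> 2" and c: "c \<noteq> 0"
    and noncrit: "\<And>r e w. inverse_boettcher_factor n c r e \<Longrightarrow> r \<le> 1 \<Longrightarrow> w \<in> ball 0 r \<Longrightarrow>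
      1 - 4 * c * (w * e w)\<^sup>2 \<noteq> 0"
  obtains e where "inverse_boettcher_factor n c 1 e"
proof -
  obtain r0 e0 where r0: "0 < r0" "r0 \<le> 1" and e0: "inverse_boettcher_factor n c r0 e0"
    using local_inverse_boettcher_factor[OF n] by blast
  define r where "r = (\<lambda>j. root (n ^ j) r0)"
  have r_bounds: "0 < r j" "r j \<le> 1" for j
    using r0 n by (auto simp: r_def real_root_gt_zero)
  have r_Suc: "r (Suc j) ^ n = r j" for j
    using n r_bounds[of j] by (simp add: r_def real_root_mult_exp[of n])
  have r_mono: "r i \<le> r j" if "i \<le> j" for i j
  proof (rule lift_Suc_mono_le[OF _ that])
    fix j show "r j \<le> r (Suc j)"
      using r_Suc[of j] r_bounds[of "Suc j"] power_decreasing[of 1 n "r (Suc j)"] n by auto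
  qed
  have "\<exists>f. \<forall>j. inverse_boettcher_factor n c (r j) (f j) \<and> (\<forall>w \<in> ball 0 (r j). f (Suc j) w = f j w)"
  proof (rule dependent_nat_choice)
    show "\<exists>e. inverse_boettcher_factor n c (r 0) e" using e0 by (auto simp: r_def)
    fix e j assume "inverse_boettcher_factor n c (r j) e"
    then show "\<exists>e'. inverse_boettcher_factor n c (r (Suc j)) e' \<and> (\<forall>w \<in> ball 0 (r j). e' w = e w)"
      using inverse_boettcher_factor_extend[OF _ n c r_bounds(1) r_bounds(2) r_bounds(1) r_Suc]
        noncrit r_bounds(2) by metis
  qed
  then obtain f where f: "\<And>j. inverse_boettcher_factor n c (r j) (f j)"
      and step: "\<And>j w. w \<in> ball 0 (r j) \<Longrightarrow> f (Suc j) w = f j w" by blast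
  have f_eq: "f k w = f j w" if "j \<le> k" "w \<in> ball 0 (r j)" for j k w
    using that
  proof (induction k rule: dec_induct)
    case (step k)
    then show ?case using \<open>\<And>j w. w \<in> ball 0 (r j) \<Longrightarrow> f (Suc j) w = f j w\<close> r_mono
      by (metis mem_ball order_less_le_trans)
  qed simp
  define e where "e = (\<lambda>w. f (LEAST j. w \<in> ball 0 (r j)) w)"
  have e_eq: "e w = f j w" if "w \<in> ball 0 (r j)" for j w
    unfolding e_def using that f_eq[of "LEAST j. w \<in> ball 0 (r j)" j w]
    by (metis LeastI Least_le)
  have "strict_mono (\<lambda>j. n ^ j)"
    using n by (intro strict_monoI power_strict_increasing) auto
  then have "(\<lambda>j. root (n ^ j) r0) \<longlonglongrightarrow> 1"
    by (rule filterlim_compose[OF LIMSEQ_root_const[OF r0(1)] filterlim_subseq])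
  then have ex: "\<exists>j. w \<in> ball 0 (r j)" if "w \<in> ball 0 1" for w :: complex
    using order_tendstoD(1)[of r 1 sequentially "norm w"] that
    by (auto simp: r_def eventually_sequentially)
  have ex2: "\<exists>j. a \<in> ball 0 (r j) \<and> b \<in> ball 0 (r j)"
    if ab: "a \<in> ball 0 1" "b \<in> ball 0 1" for a b :: complex
  proof -
    obtain i j where "a \<in> ball 0 (r i)" "b \<in> ball 0 (r j)"
      using ex[OF ab(1)] ex[OF ab(2)] by auto
    then show ?thesis
      using r_mono[of i "max i j"] r_mono[of j "max i j"] by (intro exI[of _ "max i j"]) auto
  qed
  have "inverse_boettcher_factor n c 1 e"
    unfolding inverse_boettcher_factor_def
  proof (intro conjI ballI)
    have "e holomorphic_on ball 0 (r j)" for j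
      using f[of j] e_eq holomorphic_cong unfolding inverse_boettcher_factor_def by metis
    then have "e holomorphic_on (\<Union>j. ball 0 (r j))"
      by (intro holomorphic_on_UN_open) auto
    then show "e holomorphic_on ball 0 1"
      by (rule holomorphic_on_subset) (use ex in blast)
    show "e 0 = 1"
      using f[of 0] e_eq[of 0 0] r_bounds by (auto simp: inverse_boettcher_factor_def)
    show "inj_on (\<lambda>w. w * e w) (ball 0 1)"
    proof (rule inj_onI)
      fix a b assume "a \<in> ball 0 1" "b \<in> ball 0 1" "a * e a = b * e b"
      then obtain j where "a \<in> ball 0 (r j)" "b \<in> ball 0 (r j)" "a * f j a = b * f j b"
        using ex2 e_eq by metis
      then show "a = b"
        using f[of j] unfolding inverse_boettcher_factor_def by (auto dest: inj_onD)
    qed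
    fix w :: complex assume "w \<in> ball 0 1"
    then obtain j where w: "w \<in> ball 0 (r j)" using ex by blast
    have wn: "w ^ n \<in> ball 0 (r j)"
      using norm_power_less_radius[of w "r j" n] w r_bounds[of j] n by simp
    show "e w \<noteq> 0" "e w ^ n = (1 + c * (w * e w) ^ (2 * n)) * e (w ^ n)"
      using f[of j] w wn unfolding inverse_boettcher_factor_def e_eq[OF w] e_eq[OF wn] by auto
  qed
  then show thesis using that by blast
qed

section \<open>The conjugacy on the sphere and the critical values\<close>

lemma inv_coord_None_inj: "inv_coord None x = inv_coord None y \<longleftrightarrow> x = y"
  by (auto split: if_splits)

lemma mcmullen_map_inverse_boettcher:
  assumes e: "inverse_boettcher_factor n c r e" and r: "r \<le> 1" and n: "n \<ge> 2" and w: "w \<in> ball 0 r"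
  shows "(mcmullen_map n c ^^ k) (inv_coord None (w * e w))
       = inv_coord None (w ^ n ^ k * e (w ^ n ^ k))"
    and "w ^ n ^ k \<in> ball 0 r"
proof -
  have step: "mcmullen_map n c (inv_coord None (w * e w)) = inv_coord None (w ^ n * e (w ^ n))"
    if w: "w \<in> ball 0 r" for w
  proof (cases "w = 0")
    case True
    then show ?thesis using n by (simp add: power_0_left)
  next
    case False
    have wn: "w ^ n \<in> ball 0 r" using norm_power_less_radius[of w r n] w r n by simp
    define x where "x = w * e w"
    have x: "x \<noteq> 0" and nz: "w ^ n * e (w ^ n) \<noteq> 0"
      using e False w wn unfolding inverse_boettcher_factor_def x_def by auto
    have x_eq: "x ^ n = (1 + c * x ^ (2 * n)) * (w ^ n * e (w ^ n))"
      using e w unfolding inverse_boettcher_factor_def x_def by (simp add: power_mult_distrib)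
    then have "1 + c * x ^ (2 * n) \<noteq> 0" using x by (metis mult_zero_left power_not_zero)
    then have "inverse (w ^ n * e (w ^ n)) = (1 + c * x ^ (2 * n)) / x ^ n"
      using nz by (subst x_eq) (simp add: divide_simps)
    also have "\<dots> = inverse x ^ n + c / inverse x ^ n"
      using x by (simp add: field_simps power_mult power2_eq_square mult.commute[of 2])
    finally show ?thesis using x nz by (simp add: x_def)
  qed
  have "(mcmullen_map n c ^^ k) (inv_coord None (w * e w))
       = inv_coord None (w ^ n ^ k * e (w ^ n ^ k)) \<and> w ^ n ^ k \<in> ball 0 r"
  proof (induction k)
    case (Suc k)
    then have "(w ^ n ^ k) ^ n \<in> ball 0 r"
      using norm_power_less_radius[of "w ^ n ^ k" r n] r n by simp
    then show ?case
      using Suc step[of "w ^ n ^ k"] by (simp add: power_mult mult.commute[of n])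
  qed (use w in simp)
  then show "(mcmullen_map n c ^^ k) (inv_coord None (w * e w))
       = inv_coord None (w ^ n ^ k * e (w ^ n ^ k))" "w ^ n ^ k \<in> ball 0 r" by auto
qed

lemma mcmullen_critical_point:
  assumes n: "n \<ge> 2" and a: "a \<noteq> 0" "a ^ (2 * n) = c"
  shows "critical_point (mcmullen_map n c) (Some a)"
proof -
  let ?g = "\<lambda>w. (a + w) ^ n + c / (a + w) ^ n - (a ^ n + c / a ^ n)"
  have c: "c = a ^ n * a ^ n" using a(2) by (simp only: mult_2 power_add)
  have "(?g has_field_derivative
      of_nat n * a ^ (n - 1) - c * (of_nat n * a ^ (n - 1)) / (a ^ n * a ^ n)) (at 0)"
    using a(1) by (auto intro!: derivative_eq_intros)
  moreover have "of_nat n * a ^ (n - 1) - c * (of_nat n * a ^ (n - 1)) / (a ^ n * a ^ n) = 0"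
    using a(1) unfolding c by simp
  ultimately have "(?g has_field_derivative 0) (at 0)" by metis
  moreover have "eventually (\<lambda>w. w \<in> - {-a}) (nhds 0)"
    using a by (intro eventually_nhds_in_open) auto
  then have "eventually (\<lambda>w. ?g w = coord (mcmullen_map n c (Some a))
      (mcmullen_map n c (inv_coord (Some a) w))) (nhds 0)"
    by eventually_elim (use a in \<open>auto simp: add_eq_0_iff\<close>)
  ultimately show ?thesis
    unfolding critical_point_def by (subst (asm) DERIV_cong_ev[OF refl _ refl])
qed

text \<open>
  A zero of the discriminant means that \<open>1 / (w * e w)\<close> is one of the critical values \<open>2 * s\<close> with
  \<open>s\<^sup>2 = c\<close>. Its orbit is \<open>1 / \<psi> (w ^ n ^ k)\<close> with \<open>w \<noteq> 0\<close>, and these points are pairwise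
  distinct because \<open>\<psi>\<close> is injective and the moduli of \<open>w ^ n ^ k\<close> strictly decrease.
\<close>

lemma postcritically_finite_imp_noncritical:
  assumes pcf: "postcritically_finite (mcmullen_map n c)" and n: "n \<ge> 2" and c: "c \<noteq> 0"
    and e: "inverse_boettcher_factor n c r e" and r: "r \<le> 1" and w: "w \<in> ball 0 r"
  shows "1 - 4 * c * (w * e w)\<^sup>2 \<noteq> 0"
proof
  assume "1 - 4 * c * (w * e w)\<^sup>2 = 0"
  then have eq: "4 * c * (w * e w)\<^sup>2 = 1" by simp
  then have w0: "w \<noteq> 0" by auto
  have x0: "w * e w \<noteq> 0" using eq by auto
  define s where "s = 1 / (2 * (w * e w))"
  have s: "s \<noteq> 0" "s\<^sup>2 = c" "inv_coord None (w * e w) = Some (2 * s)"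
    using eq x0 by (auto simp: s_def power_divide power_mult_distrib field_simps)
  obtain a where a: "a ^ n = s"
    using exists_complex_root[of n s] n by auto
  have a0: "a \<noteq> 0" "a ^ (2 * n) = c"
    using a s n by (auto simp: power_mult mult.commute[of 2] power_0_left)
  let ?f = "mcmullen_map n c"
  have fa: "?f (Some a) = inv_coord None (w * e w)"
    using a a0 s by (simp add: power2_eq_square flip: s(2))
  obtain k m where m: "m > 0" and per: "(?f ^^ (k + m)) (Some a) = (?f ^^ k) (Some a)"
    using pcf mcmullen_critical_point[OF n a0]
    unfolding postcritically_finite_def eventually_periodic_def by blast
  have "(?f ^^ (k + m)) (?f (Some a)) = (?f ^^ k) (?f (Some a))"
    using arg_cong[OF per, of ?f] by (simp add: funpow_swap1)
  then have "w ^ n ^ (k + m) * e (w ^ n ^ (k + m)) = w ^ n ^ k * e (w ^ n ^ k)"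
    unfolding fa mcmullen_map_inverse_boettcher(1)[OF e r n w] inv_coord_None_inj .
  then have "w ^ n ^ (k + m) = w ^ n ^ k"
    using e mcmullen_map_inverse_boettcher(2)[OF e r n w]
    unfolding inverse_boettcher_factor_def by (auto dest: inj_onD)
  then have "norm w ^ n ^ (k + m) = norm w ^ n ^ k" by (metis norm_power)
  moreover have "norm w ^ n ^ (k + m) < norm w ^ n ^ k"
    using w r w0 m n by (intro power_strict_decreasing power_strict_increasing) auto
  ultimately show False by simp
qed

lemma postcritically_finite_imp_inverse_boettcher_factor:
  assumes pcf: "postcritically_finite (mcmullen_map n c)" and n: "n \<ge> 2" and c: "c \<noteq> 0"
  obtains e where "inverse_boettcher_factor n c 1 e"
proof (rule global_inverse_boettcher_factor[OF n c])
  fix r e and w :: complex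
  assume "inverse_boettcher_factor n c r e" "r \<le> 1" "w \<in> ball 0 r"
  then show "1 - 4 * c * (w * e w)\<^sup>2 \<noteq> 0"
    by (rule postcritically_finite_imp_noncritical[OF pcf n c])
qed (rule that)

section \<open>The chart at infinity\<close>

lemma openin_rsphere_inv_coord_None:
  assumes "open W"
  shows "openin rsphere_top (inv_coord None ` W)"
proof -
  define V where "V = inverse ` (W - {0})"
  have V_eq: "V = (- {0}) \<inter> inverse -` W"
    unfolding V_def by (auto intro: image_eqI[where x = "inverse _"])
  have "continuous_on (- {0}) (\<lambda>y::complex. inverse y)"
    by (intro continuous_on_inverse continuous_on_id) auto
  then have open_V: "open V"
    unfolding V_eq using assms continuous_open_preimage open_Compl by blast
  have punctured: "inv_coord None ` (W - {0}) = Some ` V"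
    unfolding V_def image_image by (rule image_cong) auto
  show ?thesis
  proof (cases "0 \<in> W")
    case False
    then have "inv_coord None ` W = Some ` V" using punctured by simp
    then show ?thesis using open_V by (simp add: rsphere_top_def)
  next
    case True
    obtain d where d: "d > 0" "ball 0 d \<subseteq> W" using assms True open_contains_ball by blast
    have "norm y \<le> 1 / d" if "y \<in> - V" for y
    proof (rule ccontr)
      assume y: "\<not> norm y \<le> 1 / d"
      then have "y \<noteq> 0" using d by auto
      then have "inverse y \<in> ball 0 d" using y d by (simp add: norm_inverse) (simp add: field_simps)
      then show False using that d \<open>y \<noteq> 0\<close> by (auto simp: V_eq)
    qed
    then have "compact (- V)"
      using open_V by (auto simp: compact_eq_bounded_closed bounded_iff closed_Compl)
    moreover have "inv_coord None ` W = insert None (Some ` V)"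
      using punctured True image_insert[of "inv_coord None" 0 "W - {0}"]
      by (simp add: insert_absorb)
    ultimately show ?thesis
      unfolding rsphere_top_def openin_Alexandroff_compactification
      by (intro disjI2 exI[of _ "- V"]) (auto simp: compact_imp_closed)
  qed
qed

lemma stereo_near_infinity:
  "((\<lambda>x. stereo (inv_coord None x)) \<longlongrightarrow> (0, 1)) (nhds 0)"
proof -
  have bound: "dist (stereo (inv_coord None x)) (0, 1) \<le> 2 * norm x + 2 * norm x ^ 2" for x
  proof (cases "x = 0")
    case False
    define t where "t = norm x"
    have t: "t > 0" using False by (simp add: t_def)
    have "norm (2 * inverse x / complex_of_real (1 + (inverse t)\<^sup>2)) = 2 * inverse t / (1 + (inverse t)\<^sup>2)"
      by (simp add: norm_mult norm_divide norm_inverse t_def del: of_real_add of_real_power)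
    also have "\<dots> = 2 * t / (1 + t\<^sup>2)"
      using t by (simp add: divide_simps power2_eq_square)
    also have "\<dots> \<le> 2 * t" using t by (simp add: pos_divide_le_eq add_pos_pos mult_le_cancel_left1)
    finally have 1: "norm (2 * inverse x / complex_of_real (1 + (inverse t)\<^sup>2)) \<le> 2 * t" .
    have "((inverse t)\<^sup>2 - 1) / (1 + (inverse t)\<^sup>2) - 1 = - (2 * t\<^sup>2) / (1 + t\<^sup>2)"
      using add_pos_pos[OF zero_less_one, of "t\<^sup>2"] t
      by (simp add: divide_simps power2_eq_square) 
    moreover have "2 * t\<^sup>2 / (1 + t\<^sup>2) \<le> 2 * t\<^sup>2"
      using t by (simp add: pos_divide_le_eq add_pos_pos mult_le_cancel_left1)
    ultimately have 2: "norm (((inverse t)\<^sup>2 - 1) / (1 + (inverse t)\<^sup>2) - 1) \<le> 2 * t\<^sup>2"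
      using t by simp
    show ?thesis
      using False 1 2 norm_Pair_le[of "2 * inverse x / complex_of_real (1 + (inverse t)\<^sup>2)"
          "((inverse t)\<^sup>2 - 1) / (1 + (inverse t)\<^sup>2) - 1"]
      by (simp add: dist_norm norm_inverse t_def)
  qed simp
  have "((\<lambda>x::complex. 2 * norm x + 2 * norm x ^ 2) \<longlongrightarrow> 2 * norm (0::complex) + 2 * norm (0::complex) ^ 2) (nhds 0)"
    by (intro tendsto_intros filterlim_ident)
  then have "((\<lambda>x::complex. 2 * norm x + 2 * norm x ^ 2) \<longlongrightarrow> 0) (nhds 0)" by simp
  then have "((\<lambda>x. dist (stereo (inv_coord None x)) (0, 1)) \<longlongrightarrow> 0) (nhds 0)"
    by (rule tendsto_sandwich[OF _ _ tendsto_const, rotated 2])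
      (use bound in \<open>auto simp del: inv_coord.simps\<close>)
  then show ?thesis by (rule tendsto_dist_iff[THEN iffD2])
qed

lemma stereo_near_infinity_imp:
  assumes "d > 0"
  obtains \<epsilon> where "\<epsilon> > 0" "\<And>x. dist (stereo x) (0, 1) < \<epsilon> \<Longrightarrow> x \<in> inv_coord None ` ball 0 d"
proof
  let ?\<epsilon> = "2 / (1 + 1 / d\<^sup>2)"
  show "?\<epsilon> > 0" using assms by (simp add: add_pos_pos)
  fix x assume *: "dist (stereo x) (0, 1) < ?\<epsilon>"
  show "x \<in> inv_coord None ` ball 0 d"
  proof (cases x)
    case None
    then show ?thesis using assms by (intro image_eqI[where x = 0]) auto
  next
    case (Some y)
    define s where "s = (norm y)\<^sup>2"
    have s: "s \<ge> 0" by (simp add: s_def)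
    have "(s - 1) / (1 + s) - 1 = - (2 / (1 + s))"
      using s by (simp add: field_simps)
    then have "2 / (1 + s) < ?\<epsilon>"
      using * dist_snd_le[of "stereo x" "(0, 1)"] s by (simp add: Some dist_real_def flip: s_def)
    then have "1 / d\<^sup>2 < s"
      using frac_le[of 2 2 "1 + s" "1 + 1 / d\<^sup>2"] s by (intro not_le_imp_less) auto
    then have "1 / d < norm y"
      using assms by (metis norm_ge_zero power2_less_imp_less power_one_over s_def)
    moreover from this have "y \<noteq> 0" using assms by auto
    ultimately have "inverse y \<in> ball 0 d" using assms by (simp add: norm_inverse) (simp add: field_simps)
    then show ?thesis using \<open>y \<noteq> 0\<close> Some by (intro image_eqI[where x = "inverse y"]) auto
  qed
qed

section \<open>The immediate basin of infinity and the Fatou set\<close>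

text \<open>The basin is described in the chart \<open>\<xi> = 1 / z\<close>, where infinity is the point \<open>0\<close>.\<close>

definition immediate_basin :: "(complex \<Rightarrow> complex) \<Rightarrow> complex set" where
  "immediate_basin e = (\<lambda>w. w * e w) ` ball 0 1"

text \<open>Unfolding the chart would split every term into the cases \<open>\<xi> = 0\<close> and
  \<open>\<xi> \<noteq> 0\<close>, so it is done only on request.\<close>

declare inv_coord.simps(2) [simp del]

lemma inverse_boettcher_holomorphic:
  assumes "inverse_boettcher_factor n c r e"
  shows "(\<lambda>w. w * e w) holomorphic_on ball 0 r"
  using assms unfolding inverse_boettcher_factor_def by (auto intro!: holomorphic_intros)

lemma open_inverse_boettcher_image:
  assumes e: "inverse_boettcher_factor n c 1 e" and s: "s \<le> 1"
  shows "open ((\<lambda>w. w * e w) ` ball 0 s)"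
proof (rule open_mapping_thm3)
  have sub: "ball 0 s \<subseteq> ball (0::complex) 1" using s by auto
  show "(\<lambda>w. w * e w) holomorphic_on ball 0 s"
    using inverse_boettcher_holomorphic[OF e] sub holomorphic_on_subset by blast
  show "inj_on (\<lambda>w. w * e w) (ball 0 s)"
    using e sub unfolding inverse_boettcher_factor_def by (blast intro: inj_on_subset)
qed simp

text \<open>
  A compact subset of the basin lies in the image of a smaller disc, by a cover with images of discs
  \<open>ball 0 (t j)\<close>; there \<open>(f ^^ k) (1 / \<psi> w) = 1 / \<psi> (w ^ n ^ k)\<close> tends to infinity uniformly. A sequence of
  iterates either repeats one iterate infinitely often or has exponents tending to infinity, and
  in both cases some subsequence converges.
\<close>

lemma basin_subset_fatou_set:
  assumes e: "inverse_boettcher_factor n c 1 e" and n: "n \<ge> 2"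
  shows "inv_coord None ` immediate_basin e \<subseteq> fatou_set (mcmullen_map n c)"
proof -
  define \<psi> where "\<psi> = (\<lambda>w. w * e w)"
  let ?f = "mcmullen_map n c"
  let ?E = "\<lambda>s. inv_coord None ` \<psi> ` ball 0 s"
  have conj: "(?f ^^ k) (inv_coord None (\<psi> w)) = inv_coord None (\<psi> (w ^ n ^ k))"
    if "w \<in> ball 0 1" for w k
    unfolding \<psi>_def using mcmullen_map_inverse_boettcher(1)[OF e _ n that] by simp
  have opn: "openin rsphere_top (?E s)" if "s \<le> 1" for s
    using open_inverse_boettcher_image[OF e that] openin_rsphere_inv_coord_None
    unfolding \<psi>_def by blast
  have "isCont \<psi> 0"
    using holomorphic_on_imp_continuous_on[OF inverse_boettcher_holomorphic[OF e]]
    by (simp add: \<psi>_def continuous_on_eq_continuous_at)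
  then have "(\<psi> \<longlongrightarrow> \<psi> 0) (nhds 0)"
    unfolding continuous_at tendsto_at_iff_tendsto_nhds .
  then have psi0: "(\<psi> \<longlongrightarrow> 0) (nhds 0)" by (simp add: \<psi>_def)
  have st: "((\<lambda>u. stereo (inv_coord None (\<psi> u))) \<longlongrightarrow> (0, 1)) (nhds 0)"
    by (rule filterlim_compose[OF stereo_near_infinity psi0])
  have unif: "uniform_limit K (\<lambda>k x. stereo ((?f ^^ \<kappa> k) x)) (\<lambda>x. stereo None) sequentially"
    if K: "compactin rsphere_top K" "K \<subseteq> ?E 1" and \<kappa>: "filterlim \<kappa> at_top sequentially" for K \<kappa>
  proof -
    define t :: "nat \<Rightarrow> real" where "t = (\<lambda>j. 1 - 1 / real (Suc j))"
    have t: "t j < 1" "0 \<le> t j" for j by (auto simp: t_def field_simps)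
    define V where "V = (\<lambda>j. ?E (t j))"
    have cover: "\<exists>j. x \<in> V j" if xK: "x \<in> K" for x
    proof -
      obtain w where w: "norm w < 1" "x = inv_coord None (\<psi> w)" using xK K(2) by auto
      obtain j where "inverse (real (Suc j)) < 1 - norm w"
        using reals_Archimedean[of "1 - norm w"] w by auto
      then have "w \<in> ball 0 (t j)" by (simp add: t_def inverse_eq_divide)
      then show ?thesis unfolding V_def w(2) by blast
    qed
    have "openin rsphere_top (V j)" for j
      unfolding V_def by (rule opn[OF less_imp_le[OF t(1)]])
    then have "\<exists>\<F>. finite \<F> \<and> \<F> \<subseteq> range V \<and> K \<subseteq> \<Union> \<F>"
      by (intro compactinD[OF K(1)]) (use cover in auto)
    then obtain J where J: "finite J" "K \<subseteq> (\<Union>i\<in>J. V i)"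
      by (metis finite_subset_image)
    define j where "j = Max (insert 0 J)"
    have "V i \<subseteq> V j" if "i \<in> J" for i
    proof -
      have "i \<le> j" using J(1) that by (simp add: j_def)
      then have "t i \<le> t j" by (simp add: t_def frac_le)
      then show ?thesis unfolding V_def by (intro image_mono subset_ball)
    qed
    then have "(\<Union>i\<in>J. V i) \<subseteq> V j" by (rule UN_least)
    then have "K \<subseteq> V j" by (rule order_trans[OF J(2)])
    then have Kj: "K \<subseteq> ?E (t j)" by (simp only: V_def)
    show ?thesis
    proof (rule uniform_limitI)
      fix \<epsilon> :: real assume "\<epsilon> > 0"
      then have "eventually (\<lambda>u. dist (stereo (inv_coord None (\<psi> u))) (0, 1) < \<epsilon>) (nhds 0)"
        using tendstoD[OF st] by blast
      then obtain \<eta> where \<eta>: "\<eta> > 0"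
          "\<And>u. dist u 0 < \<eta> \<Longrightarrow> dist (stereo (inv_coord None (\<psi> u))) (0, 1) < \<epsilon>"
        unfolding eventually_nhds_metric by blast
      have "(\<lambda>k. t j ^ \<kappa> k) \<longlonglongrightarrow> 0"
        using filterlim_compose[OF LIMSEQ_power_zero \<kappa>, of "t j"] t[of j] by simp
      then have "\<forall>\<^sub>F k in sequentially. t j ^ \<kappa> k < \<eta>"
        using \<eta>(1) by (rule order_tendstoD(2))
      then show "\<forall>\<^sub>F k in sequentially. \<forall>x \<in> K. dist (stereo ((?f ^^ \<kappa> k) x)) (stereo None) < \<epsilon>"
      proof eventually_elim
        case (elim k)
        show ?case
        proof
          fix x assume "x \<in> K"
          then obtain w where w: "norm w < t j" "x = inv_coord None (\<psi> w)"
            using Kj by auto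
          have "norm (w ^ n ^ \<kappa> k) = norm w ^ n ^ \<kappa> k" by (simp add: norm_power)
          also have "\<dots> \<le> norm w ^ \<kappa> k"
            using w t(1)[of j] n less_exp[of "\<kappa> k"] power_mono[of 2 n "\<kappa> k"]
            by (intro power_decreasing) auto
          also have "\<dots> \<le> t j ^ \<kappa> k" using w by (intro power_mono) auto
          finally have "dist (w ^ n ^ \<kappa> k) 0 < \<eta>" using elim by simp
          then show "dist (stereo ((?f ^^ \<kappa> k) x)) (stereo None) < \<epsilon>"
            using \<eta>(2) conj[of w] w t(1)[of j] by simp
        qed
      qed
    qed
  qed
  have "normal_family_on (?E 1) (range (\<lambda>k. ?f ^^ k))"
    unfolding normal_family_on_def
  proof (intro allI impI)
    fix h :: "nat \<Rightarrow> rsphere \<Rightarrow> rsphere"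
    assume "range h \<subseteq> range (\<lambda>k. ?f ^^ k)"
    then have "\<forall>j. \<exists>k. h j = ?f ^^ k" by blast
    then obtain \<kappa> where \<kappa>: "\<And>j. h j = ?f ^^ \<kappa> j" by metis
    show "\<exists>r g. strict_mono r \<and> (\<forall>K. compactin rsphere_top K \<and> K \<subseteq> ?E 1 \<longrightarrow>
        uniform_limit K (\<lambda>k x. stereo (h (r k) x)) (\<lambda>x. stereo (g x)) sequentially)"
    proof (cases "\<exists>a. infinite {j. \<kappa> j = a}")
      case True
      then obtain a where a: "infinite {j. \<kappa> j = a}" by blast
      define r where "r = enumerate {j. \<kappa> j = a}"
      have "\<kappa> (r k) = a" for k
        using enumerate_in_set[OF a, of k] by (simp add: r_def)
      then have "h (r k) = ?f ^^ a" for k by (simp add: \<kappa>)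
      then show ?thesis
        using strict_mono_enumerate[OF a] uniform_limit_const
        by (intro exI[of _ r] exI[of _ "?f ^^ a"]) (auto simp: r_def)
    next
      case False
      have "filterlim \<kappa> at_top sequentially"
        unfolding filterlim_at_top eventually_sequentially
      proof
        fix Z
        have "{j. \<kappa> j < Z} = (\<Union>a<Z. {j. \<kappa> j = a})" by auto
        then have "finite {j. \<kappa> j < Z}" using False by auto
        then obtain N where "\<And>j. \<kappa> j < Z \<Longrightarrow> j < N"
          using finite_nat_set_iff_bounded by auto
        then show "\<exists>N. \<forall>j\<ge>N. Z \<le> \<kappa> j" by (meson linorder_not_le)
      qed
      then show ?thesis
        using unif by (intro exI[of _ id] exI[of _ "\<lambda>_. None"]) (auto simp: \<kappa> strict_mono_def)
    qed
  qed
  then show ?thesis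
    using opn[of 1] unfolding fatou_set_def immediate_basin_def \<psi>_def by blast
qed

text \<open>
  Suppose that the iterates were normal near \<open>1 / p\<close>. At basin points the limit function is
  infinity, so uniform convergence supplies a single iterate \<open>k\<close> that maps all basin points near
  \<open>1 / p\<close> into the image of \<open>ball 0 (1 / 2)\<close>. By injectivity these points are \<open>1 / \<psi> w\<close> with
  \<open>norm w ^ n ^ k < 1 / 2\<close>, so \<open>p\<close> lies in the image of a compact subdisc, inside the basin.
\<close>

lemma basin_frontier_disjoint_fatou_set:
  assumes e: "inverse_boettcher_factor n c 1 e" and n: "n \<ge> 2"
    and p: "p \<in> closure (immediate_basin e)" "p \<notin> immediate_basin e"
  shows "inv_coord None p \<notin> fatou_set (mcmullen_map n c)"
proof
  define \<psi> where "\<psi> = (\<lambda>w. w * e w)"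
  let ?f = "mcmullen_map n c"
  have disc: "immediate_basin e = \<psi> ` ball 0 1"
    by (simp add: immediate_basin_def \<psi>_def)
  have conj: "(?f ^^ k) (inv_coord None (\<psi> w)) = inv_coord None (\<psi> (w ^ n ^ k))" "w ^ n ^ k \<in> ball 0 1"
    if "w \<in> ball 0 1" for w k
    unfolding \<psi>_def using mcmullen_map_inverse_boettcher[OF e _ n that] by auto
  have inj: "inj_on \<psi> (ball 0 1)"
    using e unfolding inverse_boettcher_factor_def \<psi>_def by auto
  have cont: "continuous_on (ball 0 1) \<psi>"
    unfolding \<psi>_def using inverse_boettcher_holomorphic[OF e] holomorphic_on_imp_continuous_on by blast
  have "0 \<in> immediate_basin e" by (force simp: disc \<psi>_def)
  then have p0: "p \<noteq> 0" using p by auto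
  assume "inv_coord None p \<in> fatou_set ?f"
  then obtain U where U: "openin rsphere_top U" "Some (inverse p) \<in> U"
      "normal_family_on U (range (\<lambda>k. ?f ^^ k))"
    using p0 by (auto simp: fatou_set_def inv_coord.simps(2))
  have "open {y. Some y \<in> U}"
    using U(1) continuous_map_Some[of "euclidean :: complex topology"]
    by (auto simp: rsphere_top_def dest: openin_continuous_map_preimage)
  then obtain d where d: "d > 0" "cball (inverse p) d \<subseteq> {y. Some y \<in> U}"
    using U(2) open_contains_cball by blast
  define K where "K = Some ` cball (inverse p) d"
  have "compactin rsphere_top K"
    unfolding K_def rsphere_top_def
    by (rule image_compactin[OF _ continuous_map_Some]) simp
  moreover have "K \<subseteq> U" using d by (auto simp: K_def)
  ultimately obtain r g where r: "strict_mono r"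
      and lim: "uniform_limit K (\<lambda>k x. stereo ((?f ^^ r k) x)) (\<lambda>x. stereo (g x)) sequentially"
    using U(3)[unfolded normal_family_on_def, rule_format, of "\<lambda>k. ?f ^^ k"] by blast
  have g_basin: "stereo (g (inv_coord None (\<psi> w))) = (0, 1)"
    if w: "w \<in> ball 0 1" and K: "inv_coord None (\<psi> w) \<in> K" for w
  proof -
    have "(\<lambda>k. w ^ k) \<longlonglongrightarrow> 0" using w by (intro LIMSEQ_power_zero) auto
    moreover have "strict_mono (\<lambda>k. n ^ r k)"
      using r n by (auto simp: strict_mono_def)
    ultimately have "(\<lambda>k. w ^ n ^ r k) \<longlonglongrightarrow> 0"
      using filterlim_compose[OF _ filterlim_subseq, of "\<lambda>k. w ^ k"] by blast
    then have "(\<lambda>k. \<psi> (w ^ n ^ r k)) \<longlonglongrightarrow> \<psi> 0"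
      using cont by (intro isCont_tendsto_compose[of _ \<psi>]) (auto simp: continuous_on_eq_continuous_at)
    then have "(\<lambda>k. stereo (inv_coord None (\<psi> (w ^ n ^ r k)))) \<longlonglongrightarrow> (0, 1)"
      by (intro filterlim_compose[OF stereo_near_infinity]) (simp add: \<psi>_def)
    moreover have "(\<lambda>k. stereo ((?f ^^ r k) (inv_coord None (\<psi> w)))) \<longlonglongrightarrow> stereo (g (inv_coord None (\<psi> w)))"
      using tendsto_uniform_limitI[OF lim K] .
    ultimately show ?thesis
      using LIMSEQ_unique by (simp add: conj(1)[OF w])
  qed
  have "open (\<psi> ` ball 0 (1/2))"
    unfolding \<psi>_def by (rule open_inverse_boettcher_image[OF e]) simp
  moreover have "0 \<in> \<psi> ` ball 0 (1/2)" by (force simp: \<psi>_def)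
  ultimately obtain \<delta> where \<delta>: "\<delta> > 0" "ball 0 \<delta> \<subseteq> \<psi> ` ball 0 (1/2)"
    using open_contains_ball by blast
  obtain \<epsilon> where \<epsilon>: "\<epsilon> > 0" "\<And>x. dist (stereo x) (0, 1) < \<epsilon> \<Longrightarrow> x \<in> inv_coord None ` ball 0 \<delta>"
    using stereo_near_infinity_imp[OF \<delta>(1)] by blast
  obtain k where k: "\<And>x. x \<in> K \<Longrightarrow> dist (stereo ((?f ^^ k) x)) (stereo (g x)) < \<epsilon>"
    using uniform_limitD[OF lim \<epsilon>(1)] by (auto simp: eventually_sequentially)
  \<comment> \<open>The condition \<open>norm w ^ n ^ k < 1 / 2\<close> means \<open>norm w < s\<close>.\<close>
  define s where "s = root (n ^ k) (1/2)"
  have s: "s < 1" "s \<ge> 0" "s ^ n ^ k = 1/2"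
    using n by (auto simp: s_def)
  define B where "B = (- {0}) \<inter> inverse -` ball (inverse p) d"
  have "continuous_on (- {0}) (\<lambda>y::complex. inverse y)"
    by (intro continuous_on_inverse continuous_on_id) auto
  then have "open B"
    unfolding B_def using continuous_open_preimage open_Compl by blast
  have "p \<in> B" using p0 d by (simp add: B_def)
  have "B \<inter> \<psi> ` ball 0 1 \<subseteq> \<psi> ` cball 0 s"
  proof
    fix q assume "q \<in> B \<inter> \<psi> ` ball 0 1"
    then obtain w where w: "w \<in> ball 0 1" "q = \<psi> w" and q: "q \<in> B" by blast
    have "inv_coord None (\<psi> w) \<in> K" using q w by (auto simp: B_def K_def inv_coord.simps(2))
    then have "(?f ^^ k) (inv_coord None (\<psi> w)) \<in> inv_coord None ` ball 0 \<delta>"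
      using \<epsilon>(2) k g_basin[OF w(1)] by metis
    then have "\<psi> (w ^ n ^ k) \<in> ball 0 \<delta>"
      by (simp only: conj(1)[OF w(1)] image_iff inv_coord_None_inj) simp
    then obtain v where v: "v \<in> ball 0 (1/2)" "\<psi> (w ^ n ^ k) = \<psi> v" using \<delta>(2) by blast
    then have "w ^ n ^ k = v"
      using inj_onD[OF inj v(2) conj(2)[OF w(1)]] by simp
    then have "w ^ n ^ k \<in> ball 0 (1/2)" using v(1) by simp
    then have "norm w ^ n ^ k < s ^ n ^ k" by (simp add: s norm_power)
    then have "norm w < s" using s(2) power_less_imp_less_base by blast
    then show "q \<in> \<psi> ` cball 0 s" using w by auto
  qed
  moreover have "closed (\<psi> ` cball 0 s)"
    using s by (intro compact_imp_closed compact_continuous_image continuous_on_subset[OF cont]) auto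
  ultimately have "closure (B \<inter> \<psi> ` ball 0 1) \<subseteq> \<psi> ` cball 0 s"
    using closure_minimal by blast
  moreover have "p \<in> closure (B \<inter> \<psi> ` ball 0 1)"
    using open_Int_closure_subset[OF \<open>open B\<close>, of "\<psi> ` ball 0 1"] p(1) \<open>p \<in> B\<close> disc by auto
  ultimately have "p \<in> \<psi> ` ball 0 1" using s by force
  then show False using p(2) disc by simp
qed

text \<open>
  Otherwise the first basin, being connected and sharing the point \<open>0\<close> with the second, would meet the
  frontier of the second in a point of the Fatou set of one map and of the Julia set of the other.
\<close>

lemma immediate_basin_subset:
  assumes e: "inverse_boettcher_factor n c 1 e" and n: "n \<ge> 2"
    and e': "inverse_boettcher_factor n' c' 1 e'" and n': "n' \<ge> 2"
    and julia: "julia_set (mcmullen_map n c) = julia_set (mcmullen_map n' c')"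
  shows "immediate_basin e \<subseteq> immediate_basin e'"
proof (rule ccontr)
  assume "\<not> immediate_basin e \<subseteq> immediate_basin e'"
  moreover have zero: "0 \<in> immediate_basin e" for e
    by (force simp: immediate_basin_def)
  moreover have "connected (immediate_basin e)"
    unfolding immediate_basin_def
    using holomorphic_on_imp_continuous_on[OF inverse_boettcher_holomorphic[OF e]]
    by (rule connected_continuous_image) simp
  ultimately have "immediate_basin e \<inter> frontier (immediate_basin e') \<noteq> {}"
    by (intro connected_Int_frontier) blast+
  then obtain p where p: "p \<in> immediate_basin e" "p \<in> frontier (immediate_basin e')"
    by blast
  have "open (immediate_basin e')"
    unfolding immediate_basin_def by (rule open_inverse_boettcher_image[OF e']) simp
  then have "p \<in> closure (immediate_basin e')" "p \<notin> immediate_basin e'"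
    using p(2) by (auto simp: frontier_def interior_open)
  then have "inv_coord None p \<in> julia_set (mcmullen_map n' c')"
    using basin_frontier_disjoint_fatou_set[OF e' n'] by (simp add: julia_set_def)
  moreover have "inv_coord None p \<in> fatou_set (mcmullen_map n c)"
    using basin_subset_fatou_set[OF e n] p(1) by blast
  ultimately show False using julia by (simp add: julia_set_def)
qed

section \<open>Uniqueness of the parametrisation\<close>

text \<open>
  The Schwarz lemma applies to the inverse of \<open>g\<close> composed with \<open>f\<close>, a self-map of the disc that fixes
  \<open>0\<close> with derivative \<open>1\<close>.
\<close>

lemma Schwarz_univalent_eq:
  assumes f: "f holomorphic_on ball 0 1" "f 0 = 0"
    and g: "g holomorphic_on ball 0 1" "g 0 = 0" "inj_on g (ball 0 1)"
    and deriv: "deriv f 0 = deriv g 0" and image: "f ` ball 0 1 \<subseteq> g ` ball 0 1"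
    and z: "norm z < 1"
  shows "f z = g z"
proof -
  obtain k where k: "k holomorphic_on g ` ball 0 1"
      "\<And>z. z \<in> ball 0 1 \<Longrightarrow> deriv g z * deriv k (g z) = 1"
      "\<And>z. z \<in> ball 0 1 \<Longrightarrow> k (g z) = z"
    using holomorphic_has_inverse[OF g(1) open_ball g(3)] by metis
  have gk: "k u \<in> ball 0 1 \<and> g (k u) = u" if "u \<in> g ` ball 0 1" for u
    using that k(3) by auto
  have h: "(k \<circ> f) holomorphic_on ball 0 1"
    by (rule holomorphic_on_compose_gen[OF f(1) k(1) image])
  have kf: "k (f z) \<in> ball 0 1" "g (k (f z)) = f z" if "norm z < 1" for z
    using gk[of "f z"] subsetD[OF image, of "f z"] that by auto
  have k0: "k 0 = 0" using k(3)[of 0] g(2) by simp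
  have "open (g ` ball 0 1)" by (rule open_mapping_thm3[OF g(1) open_ball g(3)])
  moreover have "0 \<in> g ` ball 0 1" using g(2) by force
  ultimately have "k field_differentiable at (f 0)"
    using k(1) f(2) holomorphic_on_imp_differentiable_at by metis
  moreover have "f field_differentiable at 0"
    using f(1) holomorphic_on_imp_differentiable_at[OF _ open_ball] by auto
  ultimately have "deriv (k \<circ> f) 0 = deriv k (f 0) * deriv f 0"
    by (rule deriv_chain[rotated])
  also have "\<dots> = 1" using k(2)[of 0] f(2) g(2) deriv by (simp add: mult.commute)
  finally have d1: "deriv (k \<circ> f) 0 = 1" .
  then obtain \<alpha> where \<alpha>: "\<And>z. norm z < 1 \<Longrightarrow> (k \<circ> f) z = \<alpha> * z"
    using Schwarz_Lemma(3)[OF h, of 0] kf(1) f(2) k0 by auto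
  have "((\<lambda>z. \<alpha> * z) has_field_derivative \<alpha>) (at 0)"
    by (auto intro!: derivative_eq_intros)
  then have "((k \<circ> f) has_field_derivative \<alpha>) (at 0)"
    by (rule has_field_derivative_transform_within_open[of _ _ _ "ball 0 1"]) (use \<alpha> in auto)
  then have "\<alpha> = 1" using d1 DERIV_imp_deriv by metis
  then show ?thesis using \<alpha>[OF z] kf(2)[OF z] by simp
qed

lemma inverse_boettcher_factor_unique:
  assumes e: "inverse_boettcher_factor n c 1 e" and e': "inverse_boettcher_factor n' c' 1 e'"
    and image: "immediate_basin e \<subseteq> immediate_basin e'" and w: "norm w < 1"
  shows "e w = e' w"
proof -
  have deriv: "deriv (\<lambda>w. w * e w) 0 = 1" if "inverse_boettcher_factor n c 1 e" for n c e
  proof -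
    have "e field_differentiable at 0"
      using that holomorphic_on_imp_differentiable_at[of e "ball 0 1" 0]
      by (auto simp: inverse_boettcher_factor_def)
    then obtain d where "(e has_field_derivative d) (at 0)"
      using field_differentiable_def by blast
    then have "((\<lambda>w. w * e w) has_field_derivative 1) (at 0)"
      using that by (auto intro!: derivative_eq_intros simp: inverse_boettcher_factor_def)
    then show ?thesis by (rule DERIV_imp_deriv)
  qed
  have "w * e w = w * e' w"
  proof (rule Schwarz_univalent_eq[where f = "\<lambda>w. w * e w" and g = "\<lambda>w. w * e' w"])
    show "inj_on (\<lambda>w. w * e' w) (ball 0 1)"
      using e' by (simp add: inverse_boettcher_factor_def)
    show "(\<lambda>w. w * e w) ` ball 0 1 \<subseteq> (\<lambda>w. w * e' w) ` ball 0 1"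
      using image by (simp add: immediate_basin_def)
    show "(\<lambda>w. w * e w) holomorphic_on ball 0 1" "(\<lambda>w. w * e' w) holomorphic_on ball 0 1"
      using e e' inverse_boettcher_holomorphic by blast+
  qed (use w deriv[OF e] deriv[OF e'] in auto)
  then show ?thesis
    using e e' by (cases "w = 0") (auto simp: inverse_boettcher_factor_def)
qed

section \<open>The parameters as Taylor data\<close>

text \<open>
  With \<open>u = e - 1\<close>, of order \<open>m\<close> at \<open>0\<close>, the conjugacy equation reads
  \<open>(1 + u w) ^ n - 1 = (1 + c * (w * e w) ^ (2 * n)) * (1 + u (w ^ n)) - 1\<close>. The left side has leading term
  \<open>n * g 0 * w ^ m\<close>. On the right \<open>u (w ^ n)\<close> has order \<open>n * m > m\<close>, so the leading term must be
  \<open>c * w ^ (2 * n)\<close>.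
\<close>

lemma inverse_boettcher_factor_leading_term:
  assumes e: "inverse_boettcher_factor n c r e" and n: "n \<ge> 2" and c: "c \<noteq> 0"
    and s: "0 < s" "s \<le> r" "r \<le> 1" and m: "m > 0"
    and g: "g holomorphic_on ball 0 s" "g 0 \<noteq> 0"
    and eg: "\<And>w. w \<in> ball 0 s \<Longrightarrow> e w = 1 + w ^ m * g w"
  shows "m = 2 * n" and "of_nat n * g 0 = c"
proof -
  have e0: "e 0 = 1" using e by (simp add: inverse_boettcher_factor_def)
  have cont: "isCont e 0" "isCont g 0"
    using e g s holomorphic_on_imp_continuous_on[of e "ball 0 r"] holomorphic_on_imp_continuous_on[OF g(1)]
    by (auto simp: inverse_boettcher_factor_def continuous_on_eq_continuous_at)
  have cont_pow: "isCont (\<lambda>w. h (w ^ n)) 0" if "isCont h 0" for h :: "complex \<Rightarrow> complex"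
  proof (rule isCont_o2[where f = "\<lambda>w. w ^ n" and g = h])
    show "isCont (\<lambda>w::complex. w ^ n) 0" by (intro continuous_intros)
    show "isCont h (0 ^ n)" using that n by (simp add: power_0_left)
  qed
  \<comment> \<open>The conjugacy equation divided by \<open>w ^ m\<close>, with the terms that have a known limit on the left.\<close>
  have key: "g w * (\<Sum>i<n. e w ^ i) - w ^ (n * m - m) * g (w ^ n) * (1 + c * (w * e w) ^ (2 * n))
      = c * (e w ^ (2 * n) * (w ^ (2 * n) / w ^ m))"
    if w: "w \<in> ball 0 s" "w \<noteq> 0" for w
  proof -
    have wn: "w ^ n \<in> ball 0 s" using norm_power_less_radius[of w s n] w s n by simp
    have "w ^ m * g w * (\<Sum>i<n. e w ^ i) = e w ^ n - 1"
      using power_diff_1_eq[of "e w" n] eg[OF w(1)] by simp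
    also have "\<dots> = (1 + c * (w * e w) ^ (2 * n)) * (1 + (w ^ n) ^ m * g (w ^ n)) - 1"
      using e w s eg[OF wn] by (auto simp: inverse_boettcher_factor_def)
    also have "(w ^ n) ^ m = w ^ m * w ^ (n * m - m)"
      using n by (simp flip: power_mult power_add)
    finally have "w ^ m * (g w * (\<Sum>i<n. e w ^ i)
        - w ^ (n * m - m) * g (w ^ n) * (1 + c * (w * e w) ^ (2 * n)))
      = c * (w * e w) ^ (2 * n)"
      by (simp add: algebra_simps)
    then show ?thesis
      using w(2) by (simp add: field_simps power_mult_distrib)
  qed
  define L where "L = (\<lambda>w. g w * (\<Sum>i<n. e w ^ i)
      - w ^ (n * m - m) * g (w ^ n) * (1 + c * (w * e w) ^ (2 * n)))"
  have nm: "n * m - m > 0" using n m by (cases n) auto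
  have "isCont L 0"
    unfolding L_def by (intro continuous_intros cont cont_pow)
  moreover have "L 0 = of_nat n * g 0"
    using nm by (simp add: L_def e0)
  ultimately have "(\<lambda>w. L w) \<midarrow>0\<rightarrow> of_nat n * g 0" by (simp add: isCont_def)
  moreover have "(\<lambda>w. c * e w ^ (2 * n)) \<midarrow>0\<rightarrow> c * e 0 ^ (2 * n)"
    using cont(1) unfolding isCont_def by (intro tendsto_intros)
  ultimately have "(\<lambda>w. L w / (c * e w ^ (2 * n))) \<midarrow>0\<rightarrow> of_nat n * g 0 / (c * e 0 ^ (2 * n))"
    using c e0 by (intro tendsto_divide) auto
  moreover have "eventually (\<lambda>w. L w / (c * e w ^ (2 * n)) = w ^ (2 * n) / w ^ m) (at 0)"
    unfolding eventually_at
  proof (intro exI conjI ballI impI)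
    fix w :: complex assume "w \<noteq> 0 \<and> dist w 0 < s"
    moreover from this have "e w \<noteq> 0" using e s by (auto simp: inverse_boettcher_factor_def)
    ultimately show "L w / (c * e w ^ (2 * n)) = w ^ (2 * n) / w ^ m"
      using key[of w] c by (simp add: L_def)
  qed (rule s)
  ultimately have lim: "(\<lambda>w::complex. w ^ (2 * n) / w ^ m) \<midarrow>0\<rightarrow> of_nat n * g 0 / c"
    using e0 by (simp cong: filterlim_cong)
  have nz: "of_nat n * g 0 / c \<noteq> 0" using n g(2) c by simp
  show mn: "m = 2 * n"
  proof (rule ccontr)
    assume "m \<noteq> 2 * n"
    then consider "m < 2 * n" | "m > 2 * n" by linarith
    then show False
    proof cases
      case 1
      have "(\<lambda>w::complex. w ^ (2 * n - m)) \<midarrow>0\<rightarrow> 0 ^ (2 * n - m)"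
        by (intro tendsto_intros)
      then have "(\<lambda>w::complex. w ^ (2 * n - m)) \<midarrow>0\<rightarrow> 0"
        using 1 by (simp add: power_0_left)
      moreover have "eventually (\<lambda>w::complex. w ^ (2 * n - m) = w ^ (2 * n) / w ^ m) (at 0)"
        using 1 by (auto simp: eventually_at_filter power_diff)
      ultimately have "(\<lambda>w::complex. w ^ (2 * n) / w ^ m) \<midarrow>0\<rightarrow> 0"
        by (rule Lim_transform_eventually)
      then show False using lim nz LIM_unique by blast
    next
      case 2
      have "(\<lambda>w::complex. w ^ (m - 2 * n) * (w ^ (2 * n) / w ^ m)) \<midarrow>0\<rightarrow>
          0 ^ (m - 2 * n) * (of_nat n * g 0 / c)"
        by (intro tendsto_intros lim)
      then have "(\<lambda>w::complex. w ^ (m - 2 * n) * (w ^ (2 * n) / w ^ m)) \<midarrow>0\<rightarrow> 0"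
        using 2 by (simp add: power_0_left)
      moreover have "eventually (\<lambda>w::complex. w ^ (m - 2 * n) * (w ^ (2 * n) / w ^ m) = 1) (at 0)"
        using 2 by (auto simp: eventually_at_filter simp flip: power_add)
      ultimately have "(\<lambda>w::complex. 1::complex) \<midarrow>0\<rightarrow> 0"
        by (rule Lim_transform_eventually)
      then show False by (simp add: tendsto_const_iff)
    qed
  qed
  have "eventually (\<lambda>w::complex. w ^ (2 * n) / w ^ m = 1) (at 0)"
    by (auto simp: eventually_at_filter mn)
  then have "(\<lambda>w::complex. 1) \<midarrow>0\<rightarrow> of_nat n * g 0 / c"
    by (rule Lim_transform_eventually[OF lim])
  then show "of_nat n * g 0 = c"
    using c by (simp add: tendsto_const_iff)
qed

text \<open>
  The factor is not constant because \<open>e = 1\<close> would violate the conjugacy equation for \<open>c \<noteq> 0\<close>. Its first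
  Taylor term therefore exists and carries both \<open>n\<close> (in the order) and \<open>c\<close> (in the coefficient).
\<close>

lemma inverse_boettcher_factor_determines_parameters:
  assumes e: "inverse_boettcher_factor n c 1 e" and n: "n \<ge> 2" and c: "c \<noteq> 0"
    and e': "inverse_boettcher_factor n' c' 1 e'" and n': "n' \<ge> 2" and c': "c' \<noteq> 0"
    and eq: "\<And>w. norm w < 1 \<Longrightarrow> e w = e' w"
  shows "n = n' \<and> c = c'"
proof -
  have hol: "(\<lambda>w. e w - 1) holomorphic_on ball 0 1" and e0: "e 0 - 1 = 0"
    using e by (auto simp: inverse_boettcher_factor_def intro!: holomorphic_intros)
  have "\<not> (\<lambda>w. e w - 1) constant_on ball 0 1"
  proof
    assume "(\<lambda>w. e w - 1) constant_on ball 0 1"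
    then have const: "e w = 1" if "norm w < 1" for w
      using that e0 unfolding constant_on_def
      by (metis (no_types, lifting) centre_in_ball diff_eq_diff_eq diff_self mem_ball_0 zero_less_one)
    have half: "norm (1/2 :: complex) < 1" by simp
    have "norm ((1/2 :: complex) ^ n) < 1" by (rule norm_power_less_radius) (use n in auto)
    then have "c * (1/2) ^ (2 * n) = 0"
      using e const const[OF half] half unfolding inverse_boettcher_factor_def
      by (metis (no_types, lifting) add_cancel_right_right mem_ball_0 mult.right_neutral power_one)
    then show False using c by simp
  qed
  then obtain g s m where m: "0 < m" and s: "0 < s" "ball 0 s \<subseteq> ball (0::complex) 1"
      and g: "g holomorphic_on ball 0 s" "\<And>w. w \<in> ball 0 s \<Longrightarrow> e w - 1 = (w - 0) ^ m * g w"
        "\<And>w. w \<in> ball 0 s \<Longrightarrow> g w \<noteq> 0"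
    using holomorphic_factor_zero_nonconstant[OF hol open_ball connected_ball _ e0]
    by (metis centre_in_ball zero_less_one)
  have s1: "s \<le> 1" using s by (simp add: ball_subset_ball_iff)
  have g0: "g 0 \<noteq> 0" using g(3) s by simp
  have eg: "e w = 1 + w ^ m * g w" "e' w = 1 + w ^ m * g w" if "w \<in> ball 0 s" for w
    using g(2)[OF that] eq[of w] that s1 by (auto simp: algebra_simps)
  have "m = 2 * n" "of_nat n * g 0 = c"
    using inverse_boettcher_factor_leading_term[OF e n c s(1) s1 _ m g(1) g0 eg(1)] by simp_all
  moreover have "m = 2 * n'" "of_nat n' * g 0 = c'"
    using inverse_boettcher_factor_leading_term[OF e' n' c' s(1) s1 _ m g(1) g0 eg(2)] by simp_all
  ultimately show ?thesis by auto
qed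

theorem corollary1p4:
  fixes n n' :: nat and c c' :: complex
  assumes "n \<ge> 2" and "n' \<ge> 2"
    and "c \<noteq> 0" and "c' \<noteq> 0"
    and "postcritically_finite (mcmullen_map n c)"
    and "postcritically_finite (mcmullen_map n' c')"
    and "julia_set (mcmullen_map n c) = julia_set (mcmullen_map n' c')"
  shows "n = n' \<and> c = c'"
proof -
  obtain e where e: "inverse_boettcher_factor n c 1 e"
    using postcritically_finite_imp_inverse_boettcher_factor[OF assms(5,1,3)] by blast
  obtain e' where e': "inverse_boettcher_factor n' c' 1 e'"
    using postcritically_finite_imp_inverse_boettcher_factor[OF assms(6,2,4)] by blast
  have "immediate_basin e \<subseteq> immediate_basin e'"
    by (rule immediate_basin_subset[OF e _ e']) (use assms in auto)
  then have eq: "e w = e' w" if "norm w < 1" for w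
    using inverse_boettcher_factor_unique[OF e e' _ that] by blast
  show ?thesis
    by (rule inverse_boettcher_factor_determines_parameters[OF e _ _ e']) (use assms eq in auto)
qed

end
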